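(* Let $d\ge 1$, let $\{X_{\mathbf n}:\mathbf n\in\mathbb Z^d\}$ be a stationary random field, let $\preccurlyeq$ be a translation invariant total order on $\mathbb Z^d$, let $\{v_n\}\subset\mathbb R$, let $m\in\mathbb N$, and let $\{\mathbf N(n)\}\subset\mathbb N^d$ satisfy $N_l(n)\to\infty$ for every $l\in\{1,\dots,d\}$ and $N_1(n)N_2(n)\cdots N_d(n)\sim n^d$. Let $r_n\to\infty$, and call a sequence $\{k_n\}$ of positive integers admissible if $k_n\to\infty$, $k_n=o(r_n)$, and $\mathbf p(n):=(\lfloor N_1(n)/k_n\rfloor,\dots,\lfloor N_d(n)/k_n\rfloor)$ tends to infinity in every coordinate. Suppose that for every admissible $\{k_n\}$, with the corresponding $\mathbf p(n)$, $$\mathbb P\left(M_{\mathbf N(n)}\le v_n\right)=\mathbb P\left(M_{\mathbf p(n)}\le v_n\right)^{k_n^d}+o(1)\qquad (n\to\infty),$$ and that $\liminf_{n\to\infty}\mathbb P\left(M_{\mathbf N(n)}\le v_n\right)>0$. Let $\{k_n\}$ be admissible, with the corresponding $\mathbf p(n)$. Then $$\mathbb P\left(M_{\mathbf N(n)}\le v_n\right)=\exp\left(-n^d\,\mathbb P\left(X_{\mathbf 0}>v_n,\ M_{A((m,m,\dots,m))}\le v_n\right)\right)+o(1)\qquad (n\to\infty)$$ if and only if $$n^d\,\mathbb P\left(X_{\mathbf 0}>v_n\ge M_{A((m,m,\dots,m))},\ M_{A(\mathbf p(n))\setminus A((m,m,\dots,m))}>v_n\right)\longrightarrow 0\qquad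 (n\to\infty).$$
   Context: Stationary means that the finite-dimensional distributions are invariant under all translations of $\mathbb Z^d$. $\mathbb N$ denotes the nonnegative integers. Inequalities $\mathbf i\le\mathbf j$ between elements of $\mathbb Z^d$ are coordinatewise; $\mathbf 0=(0,\dots,0)$, $\mathbf 1=(1,\dots,1)$. For finite $A\subset\mathbb Z^d$, $M_A:=\sup\{X_{\mathbf i}:\mathbf i\in A\}$ (with $\sup\emptyset=-\infty$), and for $\mathbf n\in\mathbb N^d$, $M_{\mathbf n}:=\sup\{X_{\mathbf i}:\mathbf 1\le\mathbf i\le\mathbf n\}$. A total order $\preccurlyeq$ on $\mathbb Z^d$ is translation invariant if $\mathbf i\preccurlyeq\mathbf j$ implies $\mathbf i+\mathbf k\preccurlyeq\mathbf j+\mathbf k$ for all $\mathbf k\in\mathbb Z^d$; $\mathbf i\prec\mathbf j$ means $\mathbf i\preccurlyeq\mathbf j$ and $\mathbf i\ne\mathbf j$. For $\mathbf p\in\mathbb N^d$, $$A(\mathbf p):=\{\mathbf j\in\mathbb Z^d:\ -\mathbf p\le\mathbf j\le\mathbf p\text{ and }\mathbf 0\prec\mathbf j\}.$$ *)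

theory Defs
  imports "HOL-Probability.Probability" "HOL-Library.Landau_Symbols"
begin

text \<open>
  The dimension \<open>d\<close> is \<open>CARD('d)\<close> for a finite index type \<open>'d\<close>: the lattice is \<open>int ^ 'd\<close>,
  multi-indices in \<open>\<nat>\<^sup>d\<close> have type \<open>nat ^ 'd\<close>, and \<open>\<le>\<close> on vectors is the coordinatewise order.
\<close>

definition int_vec :: "nat ^ 'd \<Rightarrow> int ^ 'd" where
  "int_vec n = (\<chi> l. int (n $ l))"

definition stationary_field :: "'a measure \<Rightarrow> (int ^ 'd \<Rightarrow> 'a \<Rightarrow> real) \<Rightarrow> bool" where
  "stationary_field M X \<longleftrightarrow>
     (\<forall>I k. finite I \<longrightarrow>
        distr M (\<Pi>\<^sub>M i\<in>I. borel) (\<lambda>\<omega>. \<lambda>i\<in>I. X (i + k) \<omega>) =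
        distr M (\<Pi>\<^sub>M i\<in>I. borel) (\<lambda>\<omega>. \<lambda>i\<in>I. X i \<omega>))"

text \<open>Partial maxima take values in \<open>ereal\<close>, so that the maximum over the empty set is \<open>-\<infinity>\<close>.\<close>

definition field_max :: "(int ^ 'd \<Rightarrow> 'a \<Rightarrow> real) \<Rightarrow> (int ^ 'd) set \<Rightarrow> 'a \<Rightarrow> ereal" where
  "field_max X A \<omega> = (SUP i\<in>A. ereal (X i \<omega>))"

definition box_max :: "(int ^ 'd \<Rightarrow> 'a \<Rightarrow> real) \<Rightarrow> nat ^ 'd \<Rightarrow> 'a \<Rightarrow> ereal" where
  "box_max X n = field_max X {i. 1 \<le> i \<and> i \<le> int_vec n}"

text \<open>Total orders on the lattice are relations \<open>R\<close> with \<open>linear_order_on UNIV R\<close>.\<close>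

definition translation_invariant :: "(int ^ 'd) rel \<Rightarrow> bool" where
  "translation_invariant R \<longleftrightarrow> (\<forall>i j k. (i, j) \<in> R \<longrightarrow> (i + k, j + k) \<in> R)"

definition half_box :: "(int ^ 'd) rel \<Rightarrow> nat ^ 'd \<Rightarrow> (int ^ 'd) set" where
  "half_box R p = {j. - int_vec p \<le> j \<and> j \<le> int_vec p \<and> (0, j) \<in> R \<and> 0 \<noteq> j}"

definition block :: "(nat \<Rightarrow> nat ^ 'd) \<Rightarrow> (nat \<Rightarrow> nat) \<Rightarrow> nat \<Rightarrow> nat ^ 'd" where
  "block N k n = (\<chi> l. N n $ l div k n)"

definition admissible :: "(nat \<Rightarrow> nat ^ 'd) \<Rightarrow> (nat \<Rightarrow> real) \<Rightarrow> (nat \<Rightarrow> nat) \<Rightarrow> bool" where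
  "admissible N r k \<longleftrightarrow>
     (\<forall>n. 0 < k n) \<and>
     filterlim k at_top sequentially \<and>
     (\<lambda>n. real (k n)) \<in> o[sequentially](r) \<and>
     (\<forall>l. filterlim (\<lambda>n. block N k n $ l) at_top sequentially)"

end

theory Submission
  imports Defs "HOL-Library.Discrete_Functions" "HOL-Real_Asymp.Real_Asymp"
begin

text \<open>
  Writing the exceedance probability of a box as a sum over the position of its last exceedance in
  the given order, stationarity compares each summand with
  \<open>a = \<P>(X\<^sub>0 > v, M\<^bsub>A(p)\<^esub> \<le> v)\<close>: a box of size \<open>p\<close> has exceedance probability at least
  \<open>\<bar>p\<bar> a\<close>, while a larger box of size \<open>q\<close> has at most \<open>\<bar>q\<bar> a\<close> plus the contribution of its
  boundary, which is covered by few boxes of size \<open>p\<close>. Applying the first bound to \<open>k\<close> and the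
  second one to the blocks of the coarser partition given by \<open>\<lfloor>\<surd>k\<rfloor>\<close>, which is admissible as well,
  yields \<open>\<P>(M\<^bsub>N(n)\<^esub> \<le> v) = exp (- n\<^sup>d a) + o(1)\<close> with \<open>n\<^sup>d a\<close> bounded. Replacing \<open>A(p(n))\<close> by
  \<open>A(m, \<dots>, m)\<close> increases \<open>n\<^sup>d a\<close> by exactly the quantity that the condition requires to vanish.
\<close>

subsection \<open>Boxes in the lattice\<close>

text \<open>The index set of \<open>box_max\<close>, named so that its sites can be counted and
  translated.\<close>

definition lattice_box :: "nat ^ 'd \<Rightarrow> (int ^ 'd) set" where
  "lattice_box p = {i. 1 \<le> i \<and> i \<le> int_vec p}"

lemma mem_lattice_box: "i \<in> lattice_box p \<longleftrightarrow> (\<forall>l. 1 \<le> i $ l \<and> i $ l \<le> int (p $ l))"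
  by (auto simp: lattice_box_def less_eq_vec_def int_vec_def)

lemma bij_betw_vec_nth_PiE:
  "bij_betw vec_nth {x :: 'b ^ 'd. \<forall>l. x $ l \<in> A l} (PiE UNIV A)"
  by (rule bij_betw_byWitness[where f' = vec_lambda]) auto

lemma finite_vec_set:
  assumes "\<And>l. finite (A l)"
  shows "finite {x :: 'b ^ 'd. \<forall>l. x $ l \<in> A l}"
  using bij_betw_finite[OF bij_betw_vec_nth_PiE[of A]] assms by (simp add: finite_PiE)

lemma card_vec_set: "card {x :: 'b ^ 'd. \<forall>l. x $ l \<in> A l} = (\<Prod>l\<in>UNIV. card (A l))"
  using bij_betw_same_card[OF bij_betw_vec_nth_PiE[of A]] by (simp add: card_PiE)

lemma lattice_box_eq: "lattice_box p = {i. \<forall>l. i $ l \<in> {1..int (p $ l)}}"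
  by (auto simp: mem_lattice_box)

lemma finite_lattice_box [simp]: "finite (lattice_box p)"
  unfolding lattice_box_eq by (rule finite_vec_set) simp

lemma card_lattice_box: "card (lattice_box p) = (\<Prod>l\<in>UNIV. p $ l)"
  unfolding lattice_box_eq by (subst card_vec_set) simp

lemma mem_half_box:
  "j \<in> half_box R p \<longleftrightarrow>
     (\<forall>l. - int (p $ l) \<le> j $ l \<and> j $ l \<le> int (p $ l)) \<and> (0, j) \<in> R \<and> 0 \<noteq> j"
  by (auto simp: half_box_def less_eq_vec_def int_vec_def)

lemma finite_half_box [simp]: "finite (half_box R p)"
  by (rule finite_subset[OF _ finite_vec_set[of "\<lambda>l. {- int (p $ l)..int (p $ l)}"]])
     (auto simp: mem_half_box)

lemma half_box_mono:
  assumes "\<And>l. p $ l \<le> q $ l"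
  shows "half_box R p \<subseteq> half_box R q"
proof
  fix j assume j: "j \<in> half_box R p"
  have "- int (q $ l) \<le> j $ l \<and> j $ l \<le> int (q $ l)" for l
    using j assms[of l] unfolding mem_half_box by (smt (verit) of_nat_mono)
  with j show "j \<in> half_box R q" by (auto simp: mem_half_box)
qed

lemma field_max_le_iff: "field_max X A \<omega> \<le> ereal v \<longleftrightarrow> (\<forall>i\<in>A. X i \<omega> \<le> v)"
  by (simp add: field_max_def SUP_le_iff)

lemma less_field_max_iff: "ereal v < field_max X A \<omega> \<longleftrightarrow> (\<exists>i\<in>A. v < X i \<omega>)"
  by (simp add: field_max_def less_SUP_iff)

text \<open>Applied to the finite set of exceedances in a box, this provides the last
  exceedance.\<close>

lemma linear_order_finite_greatest:
  assumes "linear_order_on UNIV R" "finite A" "A \<noteq> {}"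
  shows "\<exists>i\<in>A. \<forall>j\<in>A. (j, i) \<in> R"
  using assms(2,3)
proof (induction rule: finite_ne_induct)
  case (singleton x)
  show ?case using assms(1)
    by (auto simp: order_on_defs refl_on_def)
next
  case (insert x A)
  then obtain i where i: "i \<in> A" "\<forall>j\<in>A. (j, i) \<in> R" by blast
  have tot: "(x, i) \<in> R \<or> (i, x) \<in> R" and tr: "trans R" and rf: "(x, x) \<in> R"
    using assms(1) unfolding order_on_defs refl_on_def total_on_def by (cases "x = i"; blast)+
  show ?case
    using tot
  proof
    assume "(x, i) \<in> R"
    with i show ?thesis by (intro bexI[of _ i]) auto
  next
    assume "(i, x) \<in> R"
    then have "(j, x) \<in> R" if "j \<in> A" for j
      using i that transD[OF tr] by blast
    with rf show ?thesis by (intro bexI[of _ x]) auto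
  qed
qed

subsection \<open>The last exceedance of a level in a box\<close>

locale stationary_random_field = prob_space M for M :: "'a measure" +
  fixes X :: "int ^ 'd \<Rightarrow> 'a \<Rightarrow> real"
  assumes X_measurable [measurable]: "X i \<in> borel_measurable M"
    and stationary: "stationary_field M X"
begin

definition exceed_prob :: "real \<Rightarrow> (int ^ 'd) set \<Rightarrow> real" where
  "exceed_prob v B = prob {\<omega> \<in> space M. \<exists>i\<in>B. v < X i \<omega>}"

text \<open>For \<open>B = half_box R p\<close> this is the quantity \<open>a\<close> of the
  overview: the origin exceeds the level and no site that follows it within distance
  \<open>p\<close> does.\<close>

definition last_prob :: "real \<Rightarrow> (int ^ 'd) set \<Rightarrow> real" where
  "last_prob v B = prob {\<omega> \<in> space M. v < X 0 \<omega> \<and> (\<forall>j\<in>B. X j \<omega> \<le> v)}"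

text \<open>The event is the preimage of a measurable rectangle under the coordinates in
  \<open>U \<union> B\<close>, so its probability depends only on their joint law. Taking
  \<open>U = {0}\<close> yields shifts of \<open>last_prob\<close>, and \<open>U = {}\<close> yields
  shifts of box maxima.\<close>

lemma prob_shift:
  assumes "finite U" "finite B"
  shows "prob {\<omega> \<in> space M. (\<forall>j\<in>U. v < X (j + k) \<omega>) \<and> (\<forall>j\<in>B. X (j + k) \<omega> \<le> v)} =
         prob {\<omega> \<in> space M. (\<forall>j\<in>U. v < X j \<omega>) \<and> (\<forall>j\<in>B. X j \<omega> \<le> v)}"
proof -
  let ?I = "U \<union> B"
  define S where
    "S = PiE ?I (\<lambda>i. (if i \<in> U then {v<..} else UNIV) \<inter> (if i \<in> B then {..v} else UNIV))"
  have S: "S \<in> sets (\<Pi>\<^sub>M i\<in>?I. borel)"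
    unfolding S_def using assms by (intro sets_PiM_I_finite) auto
  have eq: "prob {\<omega> \<in> space M. (\<forall>j\<in>U. v < X (j + k) \<omega>) \<and> (\<forall>j\<in>B. X (j + k) \<omega> \<le> v)} =
      measure (distr M (\<Pi>\<^sub>M i\<in>?I. borel) (\<lambda>\<omega>. \<lambda>i\<in>?I. X (i + k) \<omega>)) S" for k
  proof -
    have "measure (distr M (\<Pi>\<^sub>M i\<in>?I. borel) (\<lambda>\<omega>. \<lambda>i\<in>?I. X (i + k) \<omega>)) S =
        prob ((\<lambda>\<omega>. \<lambda>i\<in>?I. X (i + k) \<omega>) -` S \<inter> space M)"
      by (rule measure_distr) (use S in measurable)
    also have "(\<lambda>\<omega>. \<lambda>i\<in>?I. X (i + k) \<omega>) -` S \<inter> space M =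
        {\<omega> \<in> space M. (\<forall>j\<in>U. v < X (j + k) \<omega>) \<and> (\<forall>j\<in>B. X (j + k) \<omega> \<le> v)}"
      by (auto simp: S_def PiE_iff split: if_splits)
    finally show ?thesis by (rule sym)
  qed
  \<comment> \<open>The unshifted law is written as a shift by 0, so that \<open>eq\<close>
    evaluates both sides.\<close>
  have "distr M (\<Pi>\<^sub>M i\<in>?I. borel) (\<lambda>\<omega>. \<lambda>i\<in>?I. X (i + k) \<omega>) =
      distr M (\<Pi>\<^sub>M i\<in>?I. borel) (\<lambda>\<omega>. \<lambda>i\<in>?I. X (i + 0) \<omega>)"
    using stationary assms unfolding stationary_field_def add_0_right by blast
  then show ?thesis using eq[of k] eq[of 0] unfolding add_0_right by (simp only:)
qed

lemma last_prob_shift: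
  assumes "finite B"
  shows "prob {\<omega> \<in> space M. v < X i \<omega> \<and> (\<forall>j\<in>B. X (j + i) \<omega> \<le> v)} = last_prob v B"
  using prob_shift[of "{0}" B v i] assms by (simp add: last_prob_def)

lemma exceed_prob_eq:
  assumes "finite B"
  shows "prob {\<omega> \<in> space M. \<forall>i\<in>B. X i \<omega> \<le> v} = 1 - exceed_prob v B"
proof -
  have "exceed_prob v B = prob (space M - {\<omega> \<in> space M. \<forall>i\<in>B. X i \<omega> \<le> v})"
    unfolding exceed_prob_def by (rule arg_cong[where f = prob]) (auto simp: not_le)
  also have "\<dots> = 1 - prob {\<omega> \<in> space M. \<forall>i\<in>B. X i \<omega> \<le> v}"
    using assms by (intro prob_compl) measurable
  finally show ?thesis by simp
qed

lemma exceed_prob_shift: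
  assumes "finite B"
  shows "exceed_prob v ((\<lambda>j. j + k) ` B) = exceed_prob v B"
  using prob_shift[of "{}" B v k] exceed_prob_eq[of "(\<lambda>j. j + k) ` B" v] exceed_prob_eq[of B v] assms
  by simp

lemma exceed_prob_mono:
  assumes "A \<subseteq> B" "finite B"
  shows "exceed_prob v A \<le> exceed_prob v B"
  unfolding exceed_prob_def
  using assms by (intro finite_measure_mono) auto

lemma exceed_prob_UN_le:
  assumes "finite T" "\<And>t. t \<in> T \<Longrightarrow> finite (f t)"
  shows "exceed_prob v (\<Union>t\<in>T. f t) \<le> (\<Sum>t\<in>T. exceed_prob v (f t))"
proof -
  have "exceed_prob v (\<Union>t\<in>T. f t) = prob (\<Union>t\<in>T. {\<omega> \<in> space M. \<exists>i\<in>f t. v < X i \<omega>})"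
    unfolding exceed_prob_def by (rule arg_cong[where f = prob]) auto
  also have "\<dots> \<le> (\<Sum>t\<in>T. exceed_prob v (f t))"
    unfolding exceed_prob_def using assms
    by (intro finite_measure_subadditive_finite) auto
  finally show ?thesis .
qed

lemma exceed_prob_bounds: "0 \<le> exceed_prob v B" "exceed_prob v B \<le> 1"
  by (auto simp: exceed_prob_def)

lemma last_prob_nonneg: "0 \<le> last_prob v B"
  by (simp add: last_prob_def)

text \<open>For \<open>i \<in> B\<close> this says that the last exceedance in \<open>B\<close>, in
  the order \<open>R\<close>, sits at \<open>i\<close>.\<close>

definition last_event :: "(int ^ 'd) rel \<Rightarrow> real \<Rightarrow> (int ^ 'd) set \<Rightarrow> int ^ 'd \<Rightarrow> 'a set" where
  "last_event R v B i =
     {\<omega> \<in> space M. v < X i \<omega> \<and> (\<forall>j\<in>B. (i, j) \<in> R \<and> i \<noteq> j \<longrightarrow> X j \<omega> \<le> v)}"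

lemma last_event_measurable [measurable]:
  "finite B \<Longrightarrow> last_event R v B i \<in> events"
  unfolding last_event_def by measurable

text \<open>Of two distinct sites one comes later in \<open>R\<close>; a last exceedance at the
  earlier one forbids an exceedance at the later one.\<close>

lemma disjoint_last_event:
  assumes "linear_order_on UNIV R" "I \<subseteq> B"
  shows "disjoint_family_on (last_event R v B) I"
  unfolding disjoint_family_on_def
proof (intro ballI impI)
  fix i j assume ij: "i \<in> I" "j \<in> I" "i \<noteq> j"
  have "(i, j) \<in> R \<or> (j, i) \<in> R"
    using assms(1) ij(3) by (auto simp: order_on_defs total_on_def)
  then show "last_event R v B i \<inter> last_event R v B j = {}"
    using ij assms(2) unfolding last_event_def by (auto simp: not_le[symmetric])
qed

lemma exceed_prob_eq_sum_last:
  assumes "linear_order_on UNIV R" "finite B"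
  shows "exceed_prob v B = (\<Sum>i\<in>B. prob (last_event R v B i))"
proof -
  have "{\<omega> \<in> space M. \<exists>i\<in>B. v < X i \<omega>} = (\<Union>i\<in>B. last_event R v B i)"
  proof (intro equalityI subsetI)
    fix \<omega> assume \<omega>: "\<omega> \<in> {\<omega> \<in> space M. \<exists>i\<in>B. v < X i \<omega>}"
    let ?C = "{i \<in> B. v < X i \<omega>}"
    obtain i where i: "i \<in> ?C" "\<forall>j\<in>?C. (j, i) \<in> R"
      using linear_order_finite_greatest[OF assms(1), of ?C] assms(2) \<omega> by auto
    \<comment> \<open>Antisymmetry turns maximality of \<open>i\<close> among the exceedances into
      the absence of exceedances strictly after \<open>i\<close>.\<close>
    have "antisym R" using assms(1) by (auto simp: order_on_defs)
    then have "X j \<omega> \<le> v" if "j \<in> B" "(i, j) \<in> R" "i \<noteq> j" for j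
      using that i by (metis (mono_tags, lifting) antisymD mem_Collect_eq not_le)
    with i \<omega> show "\<omega> \<in> (\<Union>i\<in>B. last_event R v B i)"
      by (auto simp: last_event_def)
  qed (auto simp: last_event_def)
  then have "exceed_prob v B = prob (\<Union>i\<in>B. last_event R v B i)"
    by (simp add: exceed_prob_def)
  also have "\<dots> = (\<Sum>i\<in>B. prob (last_event R v B i))"
    using assms disjoint_last_event[OF assms(1), of B B v]
    by (intro finite_measure_finite_Union) auto
  finally show ?thesis .
qed

text \<open>Used for the boundary sites of a box: their share of the sum over last positions is
  bounded by the exceedance probability of the boundary itself.\<close>

lemma sum_last_le_exceed_prob:
  assumes "linear_order_on UNIV R" "finite B" "I \<subseteq> B"
  shows "(\<Sum>i\<in>I. prob (last_event R v B i)) \<le> exceed_prob v I"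
proof -
  have fin: "finite I" using assms finite_subset by blast
  have "(\<Sum>i\<in>I. prob (last_event R v B i)) = prob (\<Union>i\<in>I. last_event R v B i)"
    using assms fin disjoint_last_event[OF assms(1), of I B v]
    by (intro finite_measure_finite_Union[symmetric]) auto
  also have "\<dots> \<le> exceed_prob v I"
    unfolding exceed_prob_def using fin
    by (intro finite_measure_mono) (auto simp: last_event_def)
  finally show ?thesis .
qed

text \<open>Two sites of the box differ by less than \<open>p\<close> in every coordinate, so the
  sites of the box after \<open>i\<close> all lie in the half box translated to \<open>i\<close>.
  Requiring no exceedance on that whole half box is therefore stricter than
  \<open>last_event\<close>, and summing over the positions gives the bound.\<close>

lemma last_prob_half_box_le:
  assumes lin: "linear_order_on UNIV R" and inv: "translation_invariant R"
  shows "real (\<Prod>l\<in>UNIV. p $ l) * last_prob v (half_box R p) \<le> exceed_prob v (lattice_box p)"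
proof -
  have le: "last_prob v (half_box R p) \<le> prob (last_event R v (lattice_box p) i)"
    if i: "i \<in> lattice_box p" for i
  proof -
    have in_half: "j - i \<in> half_box R p"
      if j: "j \<in> lattice_box p" "(i, j) \<in> R" "i \<noteq> j" for j
    proof -
      have "(i + (- i), j + (- i)) \<in> R"
        using inv j unfolding translation_invariant_def by blast
      then have "(0, j - i) \<in> R" by simp
      moreover have "- int (p $ l) \<le> (j - i) $ l \<and> (j - i) $ l \<le> int (p $ l)" for l
      proof -
        have "1 \<le> i $ l" "i $ l \<le> int (p $ l)" "1 \<le> j $ l" "j $ l \<le> int (p $ l)"
          using i j by (auto simp: mem_lattice_box)
        then show ?thesis by simp
      qed
      ultimately show ?thesis using j by (auto simp: mem_half_box)
    qed
    have "last_prob v (half_box R p) =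
        prob {\<omega> \<in> space M. v < X i \<omega> \<and> (\<forall>j\<in>half_box R p. X (j + i) \<omega> \<le> v)}"
      by (simp add: last_prob_shift)
    also have "\<dots> \<le> prob (last_event R v (lattice_box p) i)"
    proof (rule finite_measure_mono)
      show "{\<omega> \<in> space M. v < X i \<omega> \<and> (\<forall>j\<in>half_box R p. X (j + i) \<omega> \<le> v)}
          \<subseteq> last_event R v (lattice_box p) i"
        using in_half unfolding last_event_def by fastforce
    qed measurable
    finally show ?thesis .
  qed
  have "real (\<Prod>l\<in>UNIV. p $ l) * last_prob v (half_box R p) =
      (\<Sum>i\<in>lattice_box p. last_prob v (half_box R p))"
    by (simp add: card_lattice_box)
  also have "\<dots> \<le> (\<Sum>i\<in>lattice_box p. prob (last_event R v (lattice_box p) i))"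
    by (intro sum_mono le)
  also have "\<dots> = exceed_prob v (lattice_box p)"
    by (rule exceed_prob_eq_sum_last[symmetric]) (simp_all add: lin)
  finally show ?thesis .
qed

text \<open>The set \<open>I\<close> consists of the sites whose translated box
  \<open>[-p, p]\<close> stays inside the box of size \<open>q\<close>. The remaining sites are
  covered by those tiles of size \<open>p\<close> that have an extreme index in some direction; a
  union bound over these tiles and stationarity give the estimate.\<close>

lemma exceed_prob_boundary_le:
  fixes p q :: "nat ^ 'd"
  assumes p: "\<And>l. 0 < p $ l" and c: "\<And>l. q $ l div p $ l < c"
  defines "I \<equiv> {i \<in> lattice_box q. \<forall>l. int (p $ l) < i $ l \<and> i $ l \<le> int (q $ l) - int (p $ l)}"
  shows "exceed_prob v (lattice_box q - I) \<le>
     real (3 * CARD('d) * c ^ (CARD('d) - 1)) * exceed_prob v (lattice_box p)"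
proof -
  \<comment> \<open>Tile indices in direction \<open>l\<close> that can meet the boundary. Two
    indices are needed at the upper end because the last tile may be incomplete. When the quotient
    is 0, truncated subtraction keeps the set equal to \<open>{0}\<close>.\<close>
  define S where "S = (\<lambda>l. {0, q $ l div p $ l - 1, q $ l div p $ l})"
  \<comment> \<open>Tiles with index \<open>s\<close> in direction \<open>l\<close> and any index
    below \<open>c\<close> in the other directions; \<open>h t\<close> is the translation that
    carries the box of size \<open>p\<close> onto tile \<open>t\<close>.\<close>
  define F :: "'d \<Rightarrow> nat \<Rightarrow> ('d \<Rightarrow> nat) set"
    where "F = (\<lambda>l s. PiE UNIV (\<lambda>l'. if l' = l then {s} else {..<c}))"
  define T where "T = (\<Union>l. \<Union>s\<in>S l. F l s)"
  define h where "h = (\<lambda>t :: 'd \<Rightarrow> nat. \<chi> l. int (t l) * int (p $ l))"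
  have finF: "finite (F l s)" for l s
    unfolding F_def by (intro finite_PiE) auto
  have cardF: "card (F l s) = c ^ (CARD('d) - 1)" for l s
  proof -
    have "card (F l s) = (\<Prod>l'\<in>UNIV. if l' = l then 1 else c)"
      unfolding F_def by (subst card_PiE) (auto intro!: prod.cong)
    also have "\<dots> = (\<Prod>l'\<in>UNIV - {l}. c)"
      by (subst prod.remove[of UNIV l]) (auto intro!: prod.cong)
    finally show ?thesis by simp
  qed
  have finT: "finite T"
    unfolding T_def S_def using finF by auto
  have "card T \<le> (\<Sum>l\<in>UNIV. card (\<Union>s\<in>S l. F l s))"
    unfolding T_def by (rule card_UN_le) simp
  also have "\<dots> \<le> (\<Sum>l\<in>(UNIV :: 'd set). 3 * c ^ (CARD('d) - 1))"
  proof (rule sum_mono)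
    fix l
    have "card (\<Union>s\<in>S l. F l s) \<le> (\<Sum>s\<in>S l. card (F l s))"
      by (rule card_UN_le) (simp add: S_def)
    also have "\<dots> = card (S l) * c ^ (CARD('d) - 1)"
      by (simp add: cardF)
    also have "card (S l) \<le> 3"
      by (simp add: S_def card_insert_if)
    finally show "card (\<Union>s\<in>S l. F l s) \<le> 3 * c ^ (CARD('d) - 1)"
      by simp
  qed
  finally have cardT: "card T \<le> 3 * CARD('d) * c ^ (CARD('d) - 1)"
    by (simp add: mult_ac)
  have cover: "lattice_box q - I \<subseteq> (\<Union>t\<in>T. (\<lambda>j. j + h t) ` lattice_box p)"
  proof
    fix i assume i: "i \<in> lattice_box q - I"
    \<comment> \<open>The tile that contains \<open>i\<close>; the shift by 1 is due to coordinates
      starting at 1.\<close>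
    define t where "t = (\<lambda>l. nat (i $ l - 1) div p $ l)"
    have il: "1 \<le> i $ l" "i $ l \<le> int (q $ l)" for l
      using i by (auto simp: mem_lattice_box)
    have le: "t l \<le> q $ l div p $ l" for l
      unfolding t_def using il[of l] by (intro div_le_mono) auto
    obtain l where l: "i $ l \<le> int (p $ l) \<or> int (q $ l) - int (p $ l) < i $ l"
      using i by (auto simp: I_def not_less not_le)
    have tS: "t l \<in> S l"
      using l
    proof
      assume "i $ l \<le> int (p $ l)"
      then have "t l = 0" unfolding t_def using il[of l] p[of l] by (intro div_less) linarith
      then show ?thesis by (simp add: S_def)
    next
      assume "int (q $ l) - int (p $ l) < i $ l"
      then have "q $ l - p $ l \<le> nat (i $ l - 1)" by linarith
      then have "(q $ l - p $ l) div p $ l \<le> t l"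
        unfolding t_def by (rule div_le_mono)
      \<comment> \<open>This also covers \<open>q $ l < p $ l\<close>, where both sides are
        0.\<close>
      moreover have "(q $ l - p $ l) div p $ l = q $ l div p $ l - 1"
        using p[of l] by (cases "q $ l < p $ l") (auto simp: le_div_geq)
      ultimately show ?thesis using le[of l] unfolding S_def by auto
    qed
    have "t \<in> F l (t l)"
      unfolding F_def using le_less_trans[OF le c] by (auto simp: PiE_iff)
    with tS have tT: "t \<in> T" unfolding T_def by blast
    have "i - h t \<in> lattice_box p"
      unfolding mem_lattice_box
    proof
      fix l
      have "int (t l) = (i $ l - 1) div int (p $ l)"
        unfolding t_def zdiv_int using il[of l] by simp
      then have "i $ l - 1 = int (t l) * int (p $ l) + (i $ l - 1) mod int (p $ l)"
        by (simp only: div_mult_mod_eq)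
      moreover have "0 \<le> (i $ l - 1) mod int (p $ l)" "(i $ l - 1) mod int (p $ l) < int (p $ l)"
        using p[of l] by auto
      ultimately show "1 \<le> (i - h t) $ l \<and> (i - h t) $ l \<le> int (p $ l)"
        unfolding h_def by simp
    qed
    then have "i \<in> (\<lambda>j. j + h t) ` lattice_box p"
      by (intro image_eqI[of _ _ "i - h t"]) auto
    with tT show "i \<in> (\<Union>t\<in>T. (\<lambda>j. j + h t) ` lattice_box p)" by blast
  qed
  have "exceed_prob v (lattice_box q - I) \<le> exceed_prob v (\<Union>t\<in>T. (\<lambda>j. j + h t) ` lattice_box p)"
    using cover finT by (intro exceed_prob_mono) auto
  also have "\<dots> \<le> (\<Sum>t\<in>T. exceed_prob v ((\<lambda>j. j + h t) ` lattice_box p))"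
    using finT by (intro exceed_prob_UN_le) auto
  also have "\<dots> = real (card T) * exceed_prob v (lattice_box p)"
    by (simp add: exceed_prob_shift)
  also have "\<dots> \<le> real (3 * CARD('d) * c ^ (CARD('d) - 1)) * exceed_prob v (lattice_box p)"
    by (intro mult_right_mono exceed_prob_bounds of_nat_mono cardT)
  finally show ?thesis .
qed

text \<open>For an interior site the translated half box lies in the large box, so
  \<open>last_event\<close> is stricter than the event of \<open>last_prob\<close>. Each interior
  site thus contributes at most \<open>last_prob\<close>, and the boundary sites are handled by the
  covering with tiles.\<close>

lemma exceed_prob_le:
  fixes p q :: "nat ^ 'd"
  assumes lin: "linear_order_on UNIV R" and inv: "translation_invariant R"
    and p: "\<And>l. 0 < p $ l" and c: "\<And>l. q $ l div p $ l < c"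
  shows "exceed_prob v (lattice_box q) \<le>
     real (\<Prod>l\<in>UNIV. q $ l) * last_prob v (half_box R p) +
     real (3 * CARD('d) * c ^ (CARD('d) - 1)) * exceed_prob v (lattice_box p)"
proof -
  let ?E = "last_event R v (lattice_box q)"
  define I where
    "I = {i \<in> lattice_box q. \<forall>l. int (p $ l) < i $ l \<and> i $ l \<le> int (q $ l) - int (p $ l)}"
  have le: "prob (?E i) \<le> last_prob v (half_box R p)" if i: "i \<in> I" for i
  proof -
    have "j + i \<in> lattice_box q \<and> (i, j + i) \<in> R \<and> i \<noteq> j + i" if j: "j \<in> half_box R p" for j
    proof -
      have "(0 + i, j + i) \<in> R"
        using inv j unfolding translation_invariant_def mem_half_box by blast
      moreover have "1 \<le> (j + i) $ l \<and> (j + i) $ l \<le> int (q $ l)" for l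
      proof -
        have "int (p $ l) < i $ l" "i $ l \<le> int (q $ l) - int (p $ l)"
            "- int (p $ l) \<le> j $ l" "j $ l \<le> int (p $ l)"
          using i j by (auto simp: I_def mem_half_box)
        then show ?thesis by simp
      qed
      ultimately show ?thesis using j by (auto simp: mem_lattice_box mem_half_box)
    qed
    then have "prob (?E i) \<le>
        prob {\<omega> \<in> space M. v < X i \<omega> \<and> (\<forall>j\<in>half_box R p. X (j + i) \<omega> \<le> v)}"
      by (intro finite_measure_mono) (auto simp: last_event_def)
    then show ?thesis by (simp add: last_prob_shift)
  qed
  have sub: "I \<subseteq> lattice_box q" by (auto simp: I_def)
  have "exceed_prob v (lattice_box q) = (\<Sum>i\<in>lattice_box q. prob (?E i))"
    by (rule exceed_prob_eq_sum_last) (simp_all add: lin)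
  also have "\<dots> = (\<Sum>i\<in>lattice_box q - I. prob (?E i)) + (\<Sum>i\<in>I. prob (?E i))"
    by (rule sum.subset_diff[OF sub]) simp
  also have "(\<Sum>i\<in>I. prob (?E i)) \<le> (\<Sum>i\<in>I. last_prob v (half_box R p))"
    by (intro sum_mono le)
  also have "(\<Sum>i\<in>I. last_prob v (half_box R p)) \<le> (\<Sum>i\<in>lattice_box q. last_prob v (half_box R p))"
    using sub last_prob_nonneg by (intro sum_mono2) auto
  also have "\<dots> = real (\<Prod>l\<in>UNIV. q $ l) * last_prob v (half_box R p)"
    by (simp add: card_lattice_box)
  also have "(\<Sum>i\<in>lattice_box q - I. prob (?E i)) \<le> exceed_prob v (lattice_box q - I)"
    by (rule sum_last_le_exceed_prob) (auto simp: lin)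
  also have "\<dots> \<le> real (3 * CARD('d) * c ^ (CARD('d) - 1)) * exceed_prob v (lattice_box p)"
    unfolding I_def by (rule exceed_prob_boundary_le[OF p c])
  finally show ?thesis by simp
qed

end

subsection \<open>Limits of powers and of block sizes\<close>

text \<open>Factor out \<open>exp (- a)\<close>, which is at most 1, and use
  \<open>1 - exp (- t) \<le> t\<close> for \<open>t = b - a\<close>.\<close>

lemma exp_minus_diff_le:
  fixes a b :: real
  assumes "0 \<le> a"
  shows "exp (- a) - exp (- b) \<le> \<bar>b - a\<bar>"
proof -
  have "exp (- a) - exp (- b) = exp (- a) * (1 - exp (- (b - a)))"
    by (simp add: algebra_simps flip: exp_add)
  also have "\<dots> \<le> exp (- a) * \<bar>b - a\<bar>"
    using exp_ge_add_one_self[of "- (b - a)"]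
    by (intro mult_left_mono) (linarith, simp)
  also have "\<dots> \<le> 1 * \<bar>b - a\<bar>"
    using assms by (intro mult_right_mono) auto
  finally show ?thesis by simp
qed

lemma power_diff_le:
  fixes a b :: real
  assumes "0 \<le> a" "a \<le> b"
  shows "b ^ Suc n - a ^ Suc n \<le> real (Suc n) * (b - a) * b ^ n"
proof (induction n)
  case (Suc n)
  have "b ^ Suc (Suc n) - a ^ Suc (Suc n) = b * (b ^ Suc n - a ^ Suc n) + (b - a) * a ^ Suc n"
    by (simp add: algebra_simps)
  also have "\<dots> \<le> b * (real (Suc n) * (b - a) * b ^ n) + (b - a) * b ^ Suc n"
    using Suc assms by (intro add_mono mult_left_mono power_mono) auto
  also have "\<dots> = real (Suc (Suc n)) * (b - a) * b ^ Suc n"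
    by (simp add: algebra_simps)
  finally show ?case .
qed simp

lemma power_one_minus_le_exp:
  fixes x :: real
  assumes "x \<le> 1"
  shows "(1 - x) ^ K \<le> exp (- (real K * x))"
proof -
  have "(1 - x) ^ K \<le> exp (- x) ^ K"
    using assms exp_ge_add_one_self[of "- x"] by (intro power_mono) auto
  then show ?thesis by (simp flip: exp_of_nat_mult)
qed

text \<open>The bound is uniform in \<open>x\<close>: the bases differ by at most
  \<open>x\<^sup>2\<close>, and the remaining factor \<open>exp (- x) ^ (K - 1)\<close> compensates
  when \<open>x\<close> is not small.\<close>

lemma exp_minus_power_le:
  fixes x :: real
  assumes x: "0 \<le> x" "x \<le> 1" and K: "2 \<le> K"
  shows "exp (- (real K * x)) - (1 - x) ^ K \<le> 2 * real K / (real K - 1)\<^sup>2"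
proof -
  obtain n where n: "K = Suc n" "1 \<le> n" using K by (cases K) auto
  \<comment> \<open>Since \<open>1 + x ^ 3\<close> factors as
    \<open>(1 + x) * (1 - x + x\<^sup>2)\<close>, cancelling \<open>1 + x\<close> gives the
    quadratic bound on \<open>exp (- x)\<close>.\<close>
  have "(1 + x) * exp (- x) \<le> exp x * exp (- x)"
    by (intro mult_right_mono) auto
  also have "\<dots> \<le> 1 + x ^ 3"
    using x by (simp flip: exp_add)
  also have "\<dots> = (1 + x) * (1 - x + x\<^sup>2)"
    by (simp add: algebra_simps power2_eq_square power3_eq_cube)
  finally have quad: "exp (- x) - (1 - x) \<le> x\<^sup>2"
    using x by (simp add: mult_le_cancel_left)
  have "(real n * x)\<^sup>2 / 2 \<le> exp (real n * x)"
    using exp_lower_Taylor_quadratic[of "real n * x"] x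
      mult_nonneg_nonneg[of "real n" x] by linarith
  then have "(real n * x)\<^sup>2 * exp (- (real n * x)) \<le> 2"
    by (simp add: exp_minus field_simps)
  then have peak: "x\<^sup>2 * exp (- (real n * x)) \<le> 2 / (real n)\<^sup>2"
    using n by (simp add: field_simps power_mult_distrib)
  have "exp (- (real K * x)) - (1 - x) ^ K = exp (- x) ^ Suc n - (1 - x) ^ Suc n"
    unfolding n(1)[symmetric] by (simp flip: exp_of_nat_mult)
  also have "\<dots> \<le> real (Suc n) * (exp (- x) - (1 - x)) * exp (- x) ^ n"
    using x exp_ge_add_one_self[of "- x"] by (intro power_diff_le) auto
  also have "\<dots> \<le> real (Suc n) * x\<^sup>2 * exp (- x) ^ n"
    using quad by (intro mult_left_mono mult_right_mono) auto
  also have "\<dots> = real K * (x\<^sup>2 * exp (- (real n * x)))"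
    by (simp add: n(1) flip: exp_of_nat_mult)
  also have "\<dots> \<le> real K * (2 / (real n)\<^sup>2)"
    using peak by (intro mult_left_mono) auto
  finally show ?thesis by (simp add: n(1) mult.commute)
qed

lemma exp_minus_power_tendsto_0:
  fixes x :: "nat \<Rightarrow> real" and K :: "nat \<Rightarrow> nat"
  assumes x: "\<And>n. 0 \<le> x n" "\<And>n. x n \<le> 1" and K: "filterlim K at_top sequentially"
  shows "(\<lambda>n. exp (- (real (K n) * x n)) - (1 - x n) ^ K n) \<longlonglongrightarrow> 0"
proof (rule tendsto_sandwich)
  show "\<forall>\<^sub>F n in sequentially. 0 \<le> exp (- (real (K n) * x n)) - (1 - x n) ^ K n"
    using x power_one_minus_le_exp by (intro always_eventually allI) simp
  have "\<forall>\<^sub>F n in sequentially. 2 \<le> K n"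
    using K by (auto simp: filterlim_at_top)
  then show "\<forall>\<^sub>F n in sequentially.
      exp (- (real (K n) * x n)) - (1 - x n) ^ K n \<le> 2 * real (K n) / (real (K n) - 1)\<^sup>2"
    by eventually_elim (use x exp_minus_power_le in auto)
  have "((\<lambda>t :: real. 2 * t / (t - 1)\<^sup>2) \<longlongrightarrow> 0) at_top"
    by real_asymp
  then show "(\<lambda>n. 2 * real (K n) / (real (K n) - 1)\<^sup>2) \<longlonglongrightarrow> 0"
    by (rule filterlim_compose[OF _ filterlim_compose[OF filterlim_real_sequentially K]])
qed simp

text \<open>The remainder of the division is less than \<open>k n\<close>, so the ratio lies between
  1 and \<open>1 + 1 / (N n div k n)\<close>.\<close>

lemma div_ratio_tendsto_1:
  fixes N k :: "nat \<Rightarrow> nat"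
  assumes k: "\<And>n. 0 < k n" and lim: "filterlim (\<lambda>n. N n div k n) at_top sequentially"
  shows "(\<lambda>n. real (N n) / (real (k n) * real (N n div k n))) \<longlonglongrightarrow> 1"
proof (rule tendsto_sandwich)
  have pos: "\<forall>\<^sub>F n in sequentially. 1 \<le> N n div k n"
    using lim by (auto simp: filterlim_at_top)
  have N: "real (N n) = real (k n) * real (N n div k n) + real (N n mod k n)" for n
    by (metis mult_div_mod_eq of_nat_add of_nat_mult)
  show "\<forall>\<^sub>F n in sequentially. 1 \<le> real (N n) / (real (k n) * real (N n div k n))"
    using pos
  proof eventually_elim
    case (elim n)
    then show ?case using N[of n] k[of n] by (subst le_divide_eq_1_pos) auto
  qed
  show "\<forall>\<^sub>F n in sequentially. real (N n) / (real (k n) * real (N n div k n))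
      \<le> 1 + 1 / real (N n div k n)"
    using pos
  proof eventually_elim
    case (elim n)
    have "real (N n mod k n) \<le> real (k n)"
      using k[of n] by (simp add: less_imp_le)
    then show ?case using N[of n] k[of n] elim by (simp add: field_simps del: of_nat_le_iff)
  qed
  have "((\<lambda>t :: real. 1 + 1 / t) \<longlongrightarrow> 1) at_top"
    by real_asymp
  then show "(\<lambda>n. 1 + 1 / real (N n div k n)) \<longlonglongrightarrow> 1"
    by (rule filterlim_compose[OF _ filterlim_compose[OF filterlim_real_sequentially lim]])
qed simp

lemma block_ratio_tendsto_1:
  fixes N :: "nat \<Rightarrow> nat ^ 'd"
  assumes "admissible N r k"
  shows "(\<lambda>n. (\<Prod>l\<in>UNIV. real (N n $ l)) /
    (real (k n) ^ CARD('d) * (\<Prod>l\<in>UNIV. real (block N k n $ l)))) \<longlonglongrightarrow> 1"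
proof -
  have "(\<lambda>n. \<Prod>l\<in>(UNIV :: 'd set).
      real (N n $ l) / (real (k n) * real (N n $ l div k n))) \<longlonglongrightarrow> (\<Prod>l\<in>(UNIV :: 'd set). 1)"
    using assms by (intro tendsto_prod div_ratio_tendsto_1) (auto simp: admissible_def block_def)
  then show ?thesis
    by (simp add: prod_dividef prod.distrib block_def)
qed

lemma floor_sqrt_at_top: "filterlim floor_sqrt at_top at_top"
  unfolding filterlim_at_top
proof
  fix Z :: nat
  show "\<forall>\<^sub>F n in at_top. Z \<le> floor_sqrt n"
    using eventually_ge_at_top[of "Z\<^sup>2"]
    by eventually_elim (rule le_floor_sqrtI)
qed

text \<open>Passing to the square root keeps divergence, only decreases \<open>k\<close>, and only
  enlarges the blocks.\<close>

lemma admissible_floor_sqrt: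
  assumes "admissible N r k"
  shows "admissible N r (\<lambda>n. floor_sqrt (k n))"
  unfolding admissible_def
proof (intro conjI allI)
  have k: "\<And>n. 0 < k n" "filterlim k at_top sequentially" "(\<lambda>n. real (k n)) \<in> o(r)"
      "\<And>l. filterlim (\<lambda>n. block N k n $ l) at_top sequentially"
    using assms by (auto simp: admissible_def)
  show "0 < floor_sqrt (k n)" for n using k(1) by simp
  show "filterlim (\<lambda>n. floor_sqrt (k n)) at_top sequentially"
    by (rule filterlim_compose[OF floor_sqrt_at_top k(2)])
  have "(\<lambda>n. real (floor_sqrt (k n))) \<in> O(\<lambda>n. real (k n))"
    by (intro bigoI[of _ 1] always_eventually) (auto simp: floor_sqrt_le)
  then show "(\<lambda>n. real (floor_sqrt (k n))) \<in> o(r)"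
    using k(3) by (rule landau_o.big_small_trans)
  show "filterlim (\<lambda>n. block N (\<lambda>n. floor_sqrt (k n)) n $ l) at_top sequentially" for l
  proof (rule filterlim_at_top_mono[OF k(4)[of l]])
    show "\<forall>\<^sub>F n in sequentially. block N k n $ l \<le> block N (\<lambda>n. floor_sqrt (k n)) n $ l"
      using k(1) by (intro always_eventually) (auto simp: block_def floor_sqrt_le intro!: div_le_mono2)
  qed
qed

lemma product_blocks_le:
  fixes N :: "nat \<Rightarrow> nat ^ 'd"
  shows "real (k n) ^ CARD('d) * (\<Prod>l\<in>UNIV. real (block N k n $ l)) \<le> (\<Prod>l\<in>UNIV. real (N n $ l))"
proof -
  have "real (k n) ^ CARD('d) * (\<Prod>l\<in>UNIV. real (block N k n $ l)) =
      (\<Prod>l\<in>UNIV. real (k n * (N n $ l div k n)))"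
    by (simp add: prod.distrib block_def)
  also have "\<dots> \<le> (\<Prod>l\<in>UNIV. real (N n $ l))"
    by (intro prod_mono) (auto simp del: of_nat_mult)
  finally show ?thesis .
qed

text \<open>Bounds how many blocks for \<open>k\<close> fit into one for \<open>k'\<close> along a
  coordinate. The factor 2 pays for rounding: a nonzero quotient \<open>p\<close> satisfies
  \<open>N < k (p + 1) \<le> 2 k p\<close>.\<close>

lemma block_div_block_le:
  assumes "0 < block N k n $ l" "0 < k' n"
  shows "block N k' n $ l div block N k n $ l \<le> 2 * k n div k' n"
proof -
  let ?N = "N n $ l" and ?p = "N n $ l div k n"
  have p: "0 < ?p" using assms by (simp add: block_def)
  then have "0 < k n" by (cases "k n") auto
  then have "?N < k n * Suc ?p"
    using dividend_less_times_div by (simp add: add.commute)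
  also have "\<dots> \<le> k n * (2 * ?p)"
    using p by (intro mult_le_mono2) linarith
  finally have "?N \<le> (2 * k n) * ?p" by simp
  then have "?N div (k' n * ?p) \<le> (2 * k n) * ?p div (k' n * ?p)"
    by (rule div_le_mono)
  also have "\<dots> = 2 * k n div k' n"
    using p by simp
  finally show ?thesis by (simp add: block_def div_mult2_eq)
qed

text \<open>There are \<open>k' ^ d\<close> coarse blocks, each with order
  \<open>(k / k') ^ (d - 1)\<close> boundary tiles. In total this is of order
  \<open>k' k ^ (d - 1)\<close>, which \<open>k'\<^sup>2 \<le> k\<close> turns into
  \<open>k ^ d / k'\<close>.\<close>

lemma boundary_weight_le:
  fixes k k' :: nat
  assumes "0 < k'" "k'\<^sup>2 \<le> k"
  shows "real k' ^ CARD('d::finite) * real (3 * CARD('d) * (2 * k div k' + 1) ^ (CARD('d) - 1))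
    \<le> 3 ^ CARD('d) * real CARD('d) * real k ^ CARD('d) / real k'"
proof -
  obtain e where e: "CARD('d) = Suc e"
    using zero_less_card_finite[where 'a = 'd] gr0_implies_Suc by blast
  have "k' \<le> k'\<^sup>2" using assms by (simp add: power2_eq_square)
  with assms have "k' \<le> k" by simp
  have "k' * (2 * k div k' + 1) \<le> 2 * k + k'"
    by simp
  with \<open>k' \<le> k\<close> have "k' * (2 * k div k' + 1) \<le> 3 * k" by linarith
  then have c: "real k' * real (2 * k div k' + 1) \<le> 3 * real k"
    by (metis of_nat_le_iff of_nat_mult of_nat_numeral)
  have kk: "real k' \<le> real k / real k'"
    using assms by (simp add: field_simps power2_eq_square flip: of_nat_mult)
  have "real k' ^ CARD('d) * real (3 * CARD('d) * (2 * k div k' + 1) ^ (CARD('d) - 1)) =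
      3 * real CARD('d) * real k' * (real k' * real (2 * k div k' + 1)) ^ e"
    unfolding e by (simp only: of_nat_mult of_nat_power power_mult_distrib power_Suc diff_Suc_1 of_nat_numeral mult_ac)
  also have "\<dots> \<le> 3 * real CARD('d) * (real k / real k') * (3 * real k) ^ e"
    by (intro mult_mono[OF mult_left_mono[OF kk] power_mono[OF c]]) auto
  also have "\<dots> = 3 ^ CARD('d) * real CARD('d) * real k ^ CARD('d) / real k'"
    unfolding e by (simp add: power_mult_distrib)
  finally show ?thesis .
qed

section \<open>Asymptotics of the maximum over the growing box\<close>

context stationary_random_field
begin

theorem exceed_prob_asymptotics:
  fixes v :: "nat \<Rightarrow> real" and N :: "nat \<Rightarrow> nat ^ 'd" and r :: "nat \<Rightarrow> real" and k :: "nat \<Rightarrow> nat"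
  defines "P \<equiv> \<lambda>n. 1 - exceed_prob (v n) (lattice_box (N n))"
  assumes lin: "linear_order_on UNIV R" and inv: "translation_invariant R"
    and N: "(\<lambda>n. \<Prod>l\<in>UNIV. real (N n $ l)) \<sim>[sequentially] (\<lambda>n. real n ^ CARD('d))"
    and fact: "\<And>k'. admissible N r k' \<Longrightarrow>
       (\<lambda>n. P n - (1 - exceed_prob (v n) (lattice_box (block N k' n))) ^ (k' n ^ CARD('d))) \<longlonglongrightarrow> 0"
    and \<epsilon>: "0 < \<epsilon>" "\<forall>\<^sub>F n in sequentially. \<epsilon> \<le> P n"
    and k: "admissible N r k"
  shows "(\<lambda>n. P n - exp (- (real n ^ CARD('d) * last_prob (v n) (half_box R (block N k n))))) \<longlonglongrightarrow> 0"
    and "\<exists>C. \<forall>\<^sub>F n in sequentially.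
           real n ^ CARD('d) * last_prob (v n) (half_box R (block N k n)) \<le> C"
proof -
  let ?d = "CARD('d)"
  \<comment> \<open>Here \<open>x\<close> belongs to the blocks for \<open>k\<close> and
    \<open>y\<close> to the coarser blocks for \<open>k'\<close>. \<open>D\<close> counts the sites
    of the whole box and \<open>U\<close> those covered by the blocks for \<open>k\<close>;
    \<open>D\<close>, \<open>U\<close> and \<open>n ^ d\<close> turn out to be asymptotically
    equal.\<close>
  define k' where "k' = (\<lambda>n. floor_sqrt (k n))"
  define a where "a = (\<lambda>n. last_prob (v n) (half_box R (block N k n)))"
  define x where "x = (\<lambda>n. exceed_prob (v n) (lattice_box (block N k n)))"
  define y where "y = (\<lambda>n. exceed_prob (v n) (lattice_box (block N k' n)))"
  define D where "D = (\<lambda>n. \<Prod>l\<in>UNIV. real (N n $ l))"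
  define U where "U = (\<lambda>n. real (k n) ^ ?d * (\<Prod>l\<in>UNIV. real (block N k n $ l)))"
  define u where "u = (\<lambda>n. U n * a n)"
  define w where "w = (\<lambda>n. real n ^ ?d * a n)"
  \<comment> \<open>Eventually \<open>(1 - x n) ^ (k n ^ d)\<close> is at least
    \<open>\<epsilon> / 2\<close>, hence so is its exponential upper bound; this makes
    \<open>B\<close> a bound for \<open>k n ^ d * x n\<close>.\<close>
  define B where "B = - ln (\<epsilon> / 2)"
  have k': "admissible N r k'"
    unfolding k'_def by (rule admissible_floor_sqrt[OF k])
  have k'_sq: "(k' n)\<^sup>2 \<le> k n" and k'_pos: "0 < k' n" for n
    using k by (auto simp: k'_def admissible_def)
  have k'_lim: "filterlim k' at_top sequentially"
    using k' by (simp add: admissible_def)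
  have a_nonneg: "0 \<le> a n" for n by (simp add: a_def last_prob_nonneg)
  have U_nonneg: "0 \<le> U n" for n by (simp add: U_def prod_nonneg)
  have u_nonneg: "0 \<le> u n" for n by (simp add: u_def a_nonneg U_nonneg)
  have w_nonneg: "0 \<le> w n" for n by (simp add: w_def a_nonneg)
  have x: "0 \<le> x n" "x n \<le> 1" and y: "0 \<le> y n" "y n \<le> 1" for n
    by (simp_all add: x_def y_def exceed_prob_bounds)
  have lim_x: "(\<lambda>n. P n - (1 - x n) ^ (k n ^ ?d)) \<longlonglongrightarrow> 0"
    using fact[OF k] by (simp add: x_def)
  have lim_y: "(\<lambda>n. P n - (1 - y n) ^ (k' n ^ ?d)) \<longlonglongrightarrow> 0"
    using fact[OF k'] by (simp add: y_def)
  have exp_x: "(1 - x n) ^ (k n ^ ?d) \<le> exp (- (real (k n) ^ ?d * x n))" for n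
    using power_one_minus_le_exp[of "x n" "k n ^ ?d"] x by simp
  have p_pos: "\<forall>\<^sub>F n in sequentially. \<forall>l. 0 < block N k n $ l"
    using k by (intro eventually_all_finite) (auto simp: admissible_def filterlim_at_top simp flip: Suc_le_eq)
  have n_pos: "\<forall>\<^sub>F n in sequentially. 0 < n"
    by (rule eventually_gt_at_top)
  have U_pos: "\<forall>\<^sub>F n in sequentially. 0 < U n"
    using p_pos
  proof eventually_elim
    case (elim n)
    then show ?case using k unfolding U_def
      by (intro mult_pos_pos zero_less_power prod_pos) (auto simp: admissible_def)
  qed
  have DU: "(\<lambda>n. D n / U n) \<longlonglongrightarrow> 1"
    unfolding D_def U_def by (rule block_ratio_tendsto_1[OF k])
  have nD: "(\<lambda>n. real n ^ ?d / D n) \<longlonglongrightarrow> 1"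
    unfolding D_def
  proof (rule asymp_equivD_strong)
    show "(\<lambda>n. real n ^ ?d) \<sim>[sequentially] (\<lambda>n. \<Prod>l\<in>UNIV. real (N n $ l))"
      using N by (rule asymp_equiv_symI)
    \<comment> \<open>Asymptotic equivalence reads the quotient 0/0 as 1, so simultaneous zeros must
      be excluded.\<close>
    show "\<forall>\<^sub>F n in sequentially. real n ^ ?d \<noteq> 0 \<or> (\<Prod>l\<in>UNIV. real (N n $ l)) \<noteq> 0"
      using n_pos by eventually_elim simp
  qed
  have "\<forall>\<^sub>F n in sequentially. D n \<noteq> 0"
    using order_tendstoD(1)[OF DU zero_less_one] by eventually_elim auto
  then have "\<forall>\<^sub>F n in sequentially. real n ^ ?d / D n * (D n / U n) = real n ^ ?d / U n"
    by eventually_elim simp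
  from Lim_transform_eventually[OF tendsto_mult[OF nD DU] this]
  have nU: "(\<lambda>n. real n ^ ?d / U n) \<longlonglongrightarrow> 1"
    by simp
  have u_le: "u n \<le> real (k n) ^ ?d * x n" for n
    using mult_left_mono[OF last_prob_half_box_le[OF lin inv, of "block N k n" "v n"],
        of "real (k n) ^ ?d"]
    by (simp add: u_def U_def a_def x_def mult.assoc)
  have x_bound: "\<forall>\<^sub>F n in sequentially. real (k n) ^ ?d * x n \<le> B"
    using \<epsilon>(2) order_tendstoD(2)[OF lim_x half_gt_zero[OF \<epsilon>(1)]]
  proof eventually_elim
    case (elim n)
    then have "\<epsilon> / 2 \<le> exp (- (real (k n) ^ ?d * x n))"
      using exp_x[of n] by linarith
    then have "ln (\<epsilon> / 2) \<le> ln (exp (- (real (k n) ^ ?d * x n)))"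
      using \<epsilon>(1) by (intro ln_mono) auto
    then show ?case by (simp add: B_def)
  qed
  \<comment> \<open>Any factor asymptotic to \<open>U\<close> may replace it in
    \<open>U n * a n\<close>, because \<open>u\<close> is eventually bounded by \<open>B\<close>.
    This is applied to \<open>n ^ d\<close> and to \<open>D\<close>.\<close>
  have near: "(\<lambda>n. f n * a n - u n) \<longlonglongrightarrow> 0" if f: "(\<lambda>n. f n / U n) \<longlonglongrightarrow> 1" for f
  proof (rule Lim_null_comparison)
    show "\<forall>\<^sub>F n in sequentially. norm (f n * a n - u n) \<le> B * \<bar>f n / U n - 1\<bar>"
      using U_pos x_bound
    proof eventually_elim
      case (elim n)
      have "f n * a n - u n = u n * (f n / U n - 1)"
        using elim by (simp add: u_def field_simps)
      then have "norm (f n * a n - u n) = u n * \<bar>f n / U n - 1\<bar>"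
        using u_nonneg[of n] by (simp add: abs_mult)
      also have "\<dots> \<le> B * \<bar>f n / U n - 1\<bar>"
        using elim u_le[of n] by (intro mult_right_mono) auto
      finally show ?case .
    qed
    have "(\<lambda>n. B * \<bar>f n / U n - 1\<bar>) \<longlonglongrightarrow> B * \<bar>1 - 1\<bar>"
      by (intro tendsto_intros f)
    then show "(\<lambda>n. B * \<bar>f n / U n - 1\<bar>) \<longlonglongrightarrow> 0" by simp
  qed
  have wu: "(\<lambda>n. w n - u n) \<longlonglongrightarrow> 0"
    unfolding w_def by (rule near[OF nU])
  have Dw: "(\<lambda>n. D n * a n - w n) \<longlonglongrightarrow> 0"
    using tendsto_diff[OF near[OF DU] wu] by simp
  \<comment> \<open>The boundary weight \<open>3 ^ d * d * k ^ d / k'\<close> times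
    \<open>x\<close>, with \<open>k ^ d * x\<close> bounded by \<open>B\<close>, is at most
    \<open>E / k'\<close>.\<close>
  define E where "E = 3 ^ ?d * real ?d * B"
  have y_le: "\<forall>\<^sub>F n in sequentially. real (k' n) ^ ?d * y n \<le> D n * a n + E / real (k' n)"
    using p_pos x_bound
  proof eventually_elim
    case (elim n)
    \<comment> \<open>The 1 is added because the covering estimate asks for a strict bound on the
      quotient.\<close>
    let ?c = "2 * k n div k' n + 1"
    let ?K = "real (k' n) ^ ?d"
    have "y n \<le> real (\<Prod>l\<in>UNIV. block N k' n $ l) * a n + real (3 * ?d * ?c ^ (?d - 1)) * x n"
      unfolding y_def a_def x_def using elim(1) block_div_block_le[of N k n _ k'] k'_pos
      by (intro exceed_prob_le[OF lin inv]) (auto simp: less_Suc_eq_le)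
    then have "?K * y n \<le>
        ?K * (real (\<Prod>l\<in>UNIV. block N k' n $ l) * a n + real (3 * ?d * ?c ^ (?d - 1)) * x n)"
      by (rule mult_left_mono) simp
    also have "\<dots> = (?K * (\<Prod>l\<in>UNIV. real (block N k' n $ l))) * a n +
        (?K * real (3 * ?d * ?c ^ (?d - 1))) * x n"
      by (simp only: distrib_left mult.assoc of_nat_prod)
    also have "\<dots> \<le> D n * a n + (3 ^ ?d * real ?d * real (k n) ^ ?d / real (k' n)) * x n"
      unfolding D_def using a_nonneg x product_blocks_le boundary_weight_le[OF k'_pos k'_sq]
      by (intro add_mono mult_right_mono) auto
    also have "(3 ^ ?d * real ?d * real (k n) ^ ?d / real (k' n)) * x n =
        3 ^ ?d * real ?d / real (k' n) * (real (k n) ^ ?d * x n)"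
      by simp
    also have "\<dots> \<le> 3 ^ ?d * real ?d / real (k' n) * B"
      using elim(2) by (intro mult_left_mono) auto
    finally show ?case by (simp add: E_def)
  qed
  have E_lim: "(\<lambda>n. E / real (k' n)) \<longlonglongrightarrow> 0"
    by (intro real_tendsto_divide_at_top[OF tendsto_const]
        filterlim_compose[OF filterlim_real_sequentially k'_lim])
  \<comment> \<open>The lower estimate of \<open>P\<close> needs \<open>(1 - y) ^ K\<close> to be
    nearly as large as \<open>exp (- K y)\<close>; \<open>g\<close> is the error, which vanishes
    without any control on \<open>y\<close>.\<close>
  define g where "g = (\<lambda>n. exp (- (real (k' n) ^ ?d * y n)) - (1 - y n) ^ (k' n ^ ?d))"
  have g_lim: "g \<longlonglongrightarrow> 0"
  proof -
    have "filterlim (\<lambda>n. k' n ^ ?d) at_top sequentially"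
      using k'_pos by (intro filterlim_at_top_mono[OF k'_lim] always_eventually allI self_le_power)
        (auto simp: Suc_le_eq)
    from exp_minus_power_tendsto_0[OF y this] show ?thesis by (simp add: g_def)
  qed
  have "(\<lambda>n. P n - exp (- w n)) \<longlonglongrightarrow> 0"
  proof (rule tendsto_sandwich)
    \<comment> \<open>Upper estimate, through the blocks for \<open>k\<close>:
      \<open>(1 - x) ^ K\<close> is at most \<open>exp (- K x)\<close>, hence at most
      \<open>exp (- u)\<close>.\<close>
    show "\<forall>\<^sub>F n in sequentially. P n - exp (- w n) \<le> (P n - (1 - x n) ^ (k n ^ ?d)) + \<bar>w n - u n\<bar>"
    proof (intro always_eventually allI)
      fix n
      have "exp (- (real (k n) ^ ?d * x n)) \<le> exp (- u n)"
        using u_le by simp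
      then show "P n - exp (- w n) \<le> (P n - (1 - x n) ^ (k n ^ ?d)) + \<bar>w n - u n\<bar>"
        using exp_x[of n] exp_minus_diff_le[OF u_nonneg[of n], of "w n"] by linarith
    qed
    \<comment> \<open>Lower estimate, through the coarser blocks: \<open>y_le\<close> bounds
      \<open>exp (- K y)\<close> from below.\<close>
    show "\<forall>\<^sub>F n in sequentially. (P n - (1 - y n) ^ (k' n ^ ?d)) - g n -
        \<bar>(D n * a n - w n) + E / real (k' n)\<bar> \<le> P n - exp (- w n)"
      using y_le
    proof eventually_elim
      case (elim n)
      have "exp (- (D n * a n + E / real (k' n))) \<le> exp (- (real (k' n) ^ ?d * y n))"
        using elim by simp
      then have "exp (- w n) - exp (- (real (k' n) ^ ?d * y n)) \<le> \<bar>(D n * a n - w n) + E / real (k' n)\<bar>"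
        using exp_minus_diff_le[OF w_nonneg[of n], of "D n * a n + E / real (k' n)"]
        unfolding add_diff_eq diff_add_eq by linarith
      then show ?case unfolding g_def by linarith
    qed
    show "(\<lambda>n. (P n - (1 - x n) ^ (k n ^ ?d)) + \<bar>w n - u n\<bar>) \<longlonglongrightarrow> 0"
      using tendsto_add[OF lim_x tendsto_rabs[OF wu]] by simp
    show "(\<lambda>n. (P n - (1 - y n) ^ (k' n ^ ?d)) - g n -
        \<bar>(D n * a n - w n) + E / real (k' n)\<bar>) \<longlonglongrightarrow> 0"
      using tendsto_diff[OF tendsto_diff[OF lim_y g_lim] tendsto_rabs[OF tendsto_add[OF Dw E_lim]]]
      by simp
  qed
  then show "(\<lambda>n. P n - exp (- (real n ^ ?d * last_prob (v n) (half_box R (block N k n))))) \<longlonglongrightarrow> 0"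
    by (simp add: w_def a_def)
  have "\<forall>\<^sub>F n in sequentially. w n \<le> B + 1"
    using x_bound order_tendstoD(2)[OF wu zero_less_one]
  proof eventually_elim
    case (elim n)
    then show ?case using u_le[of n] by linarith
  qed
  then show "\<exists>C. \<forall>\<^sub>F n in sequentially.
      real n ^ ?d * last_prob (v n) (half_box R (block N k n)) \<le> C"
    unfolding w_def a_def by blast
qed

end

section \<open>From the growing half box to the fixed one\<close>

text \<open>Boundedness of \<open>w\<close> keeps \<open>exp (- w n)\<close> away from 0, so
  \<open>exp (- w n) * (1 - exp (- z n))\<close> can vanish only if \<open>exp (- z n)\<close> tends
  to 1. The converse is the Lipschitz bound.\<close>

lemma exp_minus_add_tendsto_iff:
  fixes P w z :: "nat \<Rightarrow> real"
  assumes P: "(\<lambda>n. P n - exp (- w n)) \<longlonglongrightarrow> 0"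
    and w: "\<And>n. 0 \<le> w n" "\<forall>\<^sub>F n in sequentially. w n \<le> C" and z: "\<And>n. 0 \<le> z n"
  shows "(\<lambda>n. P n - exp (- (w n + z n))) \<longlonglongrightarrow> 0 \<longleftrightarrow> z \<longlonglongrightarrow> 0"
proof
  assume "(\<lambda>n. P n - exp (- (w n + z n))) \<longlonglongrightarrow> 0"
  from tendsto_diff[OF this P] have diff: "(\<lambda>n. exp (- w n) - exp (- (w n + z n))) \<longlonglongrightarrow> 0"
    by simp
  have "(\<lambda>n. 1 - exp (- z n)) \<longlonglongrightarrow> 0"
  proof (rule Lim_null_comparison)
    show "\<forall>\<^sub>F n in sequentially. norm (1 - exp (- z n)) \<le> exp C * (exp (- w n) - exp (- (w n + z n)))"
      using w(2)
    proof eventually_elim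
      case (elim n)
      have "1 - exp (- z n) = exp (w n) * (exp (- w n) - exp (- (w n + z n)))"
        by (simp add: algebra_simps flip: exp_add)
      also have "\<dots> \<le> exp C * (exp (- w n) - exp (- (w n + z n)))"
        using elim z[of n] by (intro mult_right_mono) auto
      finally show ?case using z[of n] by simp
    qed
    show "(\<lambda>n. exp C * (exp (- w n) - exp (- (w n + z n)))) \<longlonglongrightarrow> 0"
      using tendsto_mult_left[OF diff, of "exp C"] by simp
  qed
  then have "(\<lambda>n. 1 - (1 - exp (- z n))) \<longlonglongrightarrow> 1 - 0"
    by (intro tendsto_intros)
  then have "(\<lambda>n. - ln (exp (- z n))) \<longlonglongrightarrow> - ln 1"
    by (intro tendsto_minus tendsto_ln) auto
  then show "z \<longlonglongrightarrow> 0" by simp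
next
  assume z0: "z \<longlonglongrightarrow> 0"
  have "(\<lambda>n. exp (- w n) - exp (- (w n + z n))) \<longlonglongrightarrow> 0"
  proof (rule Lim_null_comparison[OF _ z0])
    show "\<forall>\<^sub>F n in sequentially. norm (exp (- w n) - exp (- (w n + z n))) \<le> z n"
    proof (intro always_eventually allI)
      fix n
      show "norm (exp (- w n) - exp (- (w n + z n))) \<le> z n"
        using exp_minus_diff_le[OF w(1)[of n], of "w n + z n"] z[of n] by simp
    qed
  qed
  from tendsto_add[OF P this] show "(\<lambda>n. P n - exp (- (w n + z n))) \<longlonglongrightarrow> 0"
    by simp
qed

theorem corollary3p3:
  fixes M :: "'a measure"
    and X :: "int ^ 'd \<Rightarrow> 'a \<Rightarrow> real"
    and R :: "(int ^ 'd) rel"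
    and v :: "nat \<Rightarrow> real"
    and m :: nat
    and N :: "nat \<Rightarrow> nat ^ 'd"
    and r :: "nat \<Rightarrow> real"
    and k :: "nat \<Rightarrow> nat"
  assumes "prob_space M"
    and "\<And>i. X i \<in> borel_measurable M"
    and "stationary_field M X"
    and "linear_order_on UNIV R"
    and "translation_invariant R"
    and "\<And>l. filterlim (\<lambda>n. N n $ l) at_top sequentially"
    and "(\<lambda>n. \<Prod>l\<in>UNIV. real (N n $ l)) \<sim>[sequentially] (\<lambda>n. real n ^ CARD('d))"
    and "filterlim r at_top sequentially"
    and "\<And>k'. admissible N r k' \<Longrightarrow>
           (\<lambda>n. \<P>(\<omega> in M. box_max X (N n) \<omega> \<le> ereal (v n))
                - \<P>(\<omega> in M. box_max X (block N k' n) \<omega> \<le> ereal (v n)) ^ (k' n ^ CARD('d)))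
             \<longlonglongrightarrow> 0"
    and "liminf (\<lambda>n. ereal (\<P>(\<omega> in M. box_max X (N n) \<omega> \<le> ereal (v n)))) > 0"
    and "admissible N r k"
  shows "((\<lambda>n. \<P>(\<omega> in M. box_max X (N n) \<omega> \<le> ereal (v n))
               - exp (- (real n ^ CARD('d) *
                    \<P>(\<omega> in M. ereal (X 0 \<omega>) > ereal (v n) \<and>
                              field_max X (half_box R (\<chi> l. m)) \<omega> \<le> ereal (v n)))))
            \<longlonglongrightarrow> 0)
         \<longleftrightarrow>
         ((\<lambda>n. real n ^ CARD('d) *
               \<P>(\<omega> in M. ereal (X 0 \<omega>) > ereal (v n) \<and>
                         ereal (v n) \<ge> field_max X (half_box R (\<chi> l. m)) \<omega> \<and>
                         field_max X (half_box R (block N k n) - half_box R (\<chi> l. m)) \<omega> > ereal (v n)))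
            \<longlonglongrightarrow> 0)"
proof -
  interpret stationary_random_field M X
    using assms(1-3) by (simp add: stationary_random_field_def stationary_random_field_axioms_def)
  define A where "A = half_box R (\<chi> l. m)"
  define H where "H = (\<lambda>n. half_box R (block N k n))"
  define P where "P = (\<lambda>n. 1 - exceed_prob (v n) (lattice_box (N n)))"
  define c where "c = (\<lambda>n. prob {\<omega> \<in> space M. v n < X 0 \<omega> \<and> (\<forall>j\<in>A. X j \<omega> \<le> v n) \<and>
      (\<exists>j\<in>H n - A. v n < X j \<omega>)})"
  have box: "\<P>(\<omega> in M. box_max X p \<omega> \<le> ereal t) = 1 - exceed_prob t (lattice_box p)" for p t
    unfolding box_max_def field_max_le_iff
    by (simp add: exceed_prob_eq flip: lattice_box_def)
  have last: "\<P>(\<omega> in M. ereal (X 0 \<omega>) > ereal (v n) \<and> field_max X A \<omega> \<le> ereal (v n)) =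
      last_prob (v n) A" for n
    by (simp add: last_prob_def field_max_le_iff)
  have c: "\<P>(\<omega> in M. ereal (X 0 \<omega>) > ereal (v n) \<and> ereal (v n) \<ge> field_max X A \<omega> \<and>
      field_max X (H n - A) \<omega> > ereal (v n)) = c n" for n
    by (simp add: c_def field_max_le_iff less_field_max_iff)
  have fact: "(\<lambda>n. P n - (1 - exceed_prob (v n) (lattice_box (block N k' n))) ^ (k' n ^ CARD('d))) \<longlonglongrightarrow> 0"
    if "admissible N r k'" for k'
    using assms(9)[OF that] by (simp add: box P_def)
  obtain \<epsilon> where \<epsilon>: "0 < \<epsilon>" "\<forall>\<^sub>F n in sequentially. \<epsilon> \<le> P n"
  proof -
    \<comment> \<open>A real number strictly between 0 and the lower limit serves as
      \<open>\<epsilon>\<close>.\<close>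
    obtain e where e: "0 < ereal e" "ereal e < liminf (\<lambda>n. ereal (P n))"
      using assms(10) ereal_dense2 unfolding box P_def zero_ereal_def by blast
    have "\<forall>\<^sub>F n in sequentially. e \<le> P n"
      using less_LiminfD[OF e(2)] by eventually_elim simp
    with e(1) show ?thesis by (intro that) auto
  qed
  note main = exceed_prob_asymptotics[OF assms(4,5,7) fact[unfolded P_def] \<epsilon>[unfolded P_def] assms(11)]
  obtain C where C: "\<forall>\<^sub>F n in sequentially. real n ^ CARD('d) * last_prob (v n) (H n) \<le> C"
    using main(2) unfolding H_def by blast
  have "\<forall>\<^sub>F n in sequentially. \<forall>l. m \<le> block N k n $ l"
    using assms(11) by (intro eventually_all_finite) (auto simp: admissible_def filterlim_at_top)
  \<comment> \<open>Once \<open>A\<close> is contained in \<open>H n\<close>, the event for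
    \<open>A\<close> splits according to whether an exceedance occurs in
    \<open>H n - A\<close>.\<close>
  then have split: "\<forall>\<^sub>F n in sequentially. last_prob (v n) A = last_prob (v n) (H n) + c n"
  proof eventually_elim
    case (elim n)
    have sub: "A \<subseteq> H n"
      unfolding A_def H_def using elim by (intro half_box_mono) simp
    have fin: "finite A" "finite (H n)" by (simp_all add: A_def H_def)
    have "last_prob (v n) A =
        prob ({\<omega> \<in> space M. v n < X 0 \<omega> \<and> (\<forall>j\<in>H n. X j \<omega> \<le> v n)} \<union>
          {\<omega> \<in> space M. v n < X 0 \<omega> \<and> (\<forall>j\<in>A. X j \<omega> \<le> v n) \<and> (\<exists>j\<in>H n - A. v n < X j \<omega>)})"
      unfolding last_prob_def using sub
      by (intro arg_cong[where f = prob]) (auto simp: not_less[symmetric])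
    also have "\<dots> = last_prob (v n) (H n) + c n"
      unfolding last_prob_def c_def using fin
      by (intro finite_measure_Union) (auto simp: not_less[symmetric])
    finally show ?case .
  qed
  \<comment> \<open>The lemma on perturbed exponents is now applied with \<open>w\<close> from the
    growing half box and with \<open>n ^ d * c n\<close> as the perturbation.\<close>
  have "(\<lambda>n. P n - exp (- (real n ^ CARD('d) * last_prob (v n) A))) \<longlonglongrightarrow> 0 \<longleftrightarrow>
      (\<lambda>n. P n - exp (- (real n ^ CARD('d) * last_prob (v n) (H n) + real n ^ CARD('d) * c n))) \<longlonglongrightarrow> 0"
    by (rule tendsto_cong) (use split in eventually_elim, simp add: distrib_left)
  also have "\<dots> \<longleftrightarrow> (\<lambda>n. real n ^ CARD('d) * c n) \<longlonglongrightarrow> 0"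
    using main(1) C unfolding H_def P_def
    by (intro exp_minus_add_tendsto_iff) (auto simp: last_prob_nonneg c_def)
  finally show ?thesis
    using last c[unfolded H_def] by (simp only: box P_def flip: A_def)
qed

end
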